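(* Let $H$ be an $\mathbb O$-Hilbert space, and let $H^*$ be the right $\mathbb O$-module of continuous $\mathbb O$-para-linear functions $f:H\to\mathbb O$, with norm $\|f\|=\sup_{\|x\|\le 1}|f(x)|$. Then there is an isometric conjugate $\mathbb O$-isomorphism $$H^*\cong H,$$ that is, a bijective real linear map $\sigma:H^*\to H$ such that $\|\sigma(f)\|=\|f\|$ and $\sigma(f\odot r)=\overline r\,\sigma(f)$ for all $f\in H^*$ and $r\in\mathbb O$ (equivalently, $\sigma^{-1}(px)=\sigma^{-1}(x)\odot\overline p$ for all $p\in\mathbb O$, $x\in H$).
   Context: $\mathbb O$ denotes the octonions, with conjugation $\overline{\,\cdot\,}$, norm $|\cdot|$ and real part $\mathrm{Re}$. A left $\mathbb O$-module is a real vector space $M$ with an $\mathbb R$-bilinear scalar multiplication $\mathbb O\times M\to M$, $1m=m$, such that $r(rm)=r^2m$ for all $r\in\mathbb O$, $m\in M$ (equivalently, $[p,q,m]:=(pq)m-p(qm)$ satisfies $[p,q,m]=-[q,p,m]$). Right $\mathbb O$-modules are defined symmetrically by $(mr)r=mr^2$. For a real linear $f:M\to\mathbb O$ put $[p,x,f]:=f(px)-pf(x)$ ($p\in\mathbb O$, $x\in M$). The map $f$ is $\mathbb O$-para-linear if $\mathrm{Re}\,[p,x,f]=0$ for all $p,x$. A pre-Hilbert left $\mathbb O$-module is a left $\mathbb O$-module $H$ with an $\mathbb R$-bilinear map $\langle\cdot,\cdot\rangle:H\times H\to\mathbb O$ ($\mathbb O$-inner product) such that: (1) $\langle\cdot,u\rangle$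 is $\mathbb O$-para-linear for all $u\in H$; (2) $\langle u,v\rangle=\overline{\langle v,u\rangle}$; (3) $\langle u,u\rangle$ is a nonnegative real number, equal to $0$ iff $u=0$. An $\mathbb O$-Hilbert space is a pre-Hilbert left $\mathbb O$-module that is complete with respect to $\|u\|=\sqrt{\langle u,u\rangle}$. The right $\mathbb O$-module structure on $H^*$ is $(f\odot r)(x):=f(x)r-[r,x,f]$. A real linear map $g$ from a left $\mathbb O$-module $M_1$ to a right $\mathbb O$-module $M_2$ is conjugate $\mathbb O$-linear if $g(px)=g(x)\overline p$ for all $p\in\mathbb O$, $x\in M_1$. *)

theory Defs
  imports "HOL-Analysis.Analysis" "HOL-Library.Function_Algebras"
begin

section \<open>The octonions\<close>

datatype octo = Octo (oRe: real) (Im1: real) (Im2: real) (Im3: real)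
  (Im4: real) (Im5: real) (Im6: real) (Im7: real)

lemma octo_eq_iff: "x = y \<longleftrightarrow> oRe x = oRe y \<and> Im1 x = Im1 y \<and> Im2 x = Im2 y \<and> Im3 x = Im3 y \<and> Im4 x = Im4 y \<and> Im5 x = Im5 y \<and> Im6 x = Im6 y \<and> Im7 x = Im7 y"
  by (auto intro: octo.expand)

instantiation octo :: real_vector
begin

definition "0 = Octo 0 0 0 0 0 0 0 0"
definition "x + y = Octo (oRe x + oRe y) (Im1 x + Im1 y) (Im2 x + Im2 y) (Im3 x + Im3 y) (Im4 x + Im4 y) (Im5 x + Im5 y) (Im6 x + Im6 y) (Im7 x + Im7 y)"
definition "- x = Octo (- oRe x) (- Im1 x) (- Im2 x) (- Im3 x) (- Im4 x) (- Im5 x) (- Im6 x) (- Im7 x)"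
definition "x - y = Octo (oRe x - oRe y) (Im1 x - Im1 y) (Im2 x - Im2 y) (Im3 x - Im3 y) (Im4 x - Im4 y) (Im5 x - Im5 y) (Im6 x - Im6 y) (Im7 x - Im7 y)" for x y :: octo
definition "scaleR c x = Octo (c * oRe x) (c * Im1 x) (c * Im2 x) (c * Im3 x) (c * Im4 x) (c * Im5 x) (c * Im6 x) (c * Im7 x)"

instance
  by intro_classes
    (simp_all add: octo_eq_iff zero_octo_def plus_octo_def uminus_octo_def minus_octo_def
      scaleR_octo_def algebra_simps)

end

text \<open>Multiplication on the basis \<open>1, e\<^sub>1, \<dots>, e\<^sub>7\<close>: \<open>e\<^sub>i e\<^sub>i = -1\<close>, distinct imaginary
  units anticommute, and \<open>e\<^sub>i e\<^sub>j = e\<^sub>k\<close> whenever \<open>(i, j, k)\<close> is a cyclic permutation of one of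
  \<open>124, 235, 346, 457, 561, 672, 713\<close>.\<close>

instantiation octo :: "{one, times}"
begin

definition "1 = Octo 1 0 0 0 0 0 0 0"

definition "x * y = Octo
    (oRe x * oRe y - Im1 x * Im1 y - Im2 x * Im2 y - Im3 x * Im3 y - Im4 x * Im4 y - Im5 x * Im5 y - Im6 x * Im6 y - Im7 x * Im7 y)
    (oRe x * Im1 y + Im1 x * oRe y + Im2 x * Im4 y + Im3 x * Im7 y - Im4 x * Im2 y + Im5 x * Im6 y - Im6 x * Im5 y - Im7 x * Im3 y)
    (oRe x * Im2 y - Im1 x * Im4 y + Im2 x * oRe y + Im3 x * Im5 y + Im4 x * Im1 y - Im5 x * Im3 y + Im6 x * Im7 y - Im7 x * Im6 y)
    (oRe x * Im3 y - Im1 x * Im7 y - Im2 x * Im5 y + Im3 x * oRe y + Im4 x * Im6 y + Im5 x * Im2 y - Im6 x * Im4 y + Im7 x * Im1 y)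
    (oRe x * Im4 y + Im1 x * Im2 y - Im2 x * Im1 y - Im3 x * Im6 y + Im4 x * oRe y + Im5 x * Im7 y + Im6 x * Im3 y - Im7 x * Im5 y)
    (oRe x * Im5 y - Im1 x * Im6 y + Im2 x * Im3 y - Im3 x * Im2 y - Im4 x * Im7 y + Im5 x * oRe y + Im6 x * Im1 y + Im7 x * Im4 y)
    (oRe x * Im6 y + Im1 x * Im5 y - Im2 x * Im7 y + Im3 x * Im4 y - Im4 x * Im3 y - Im5 x * Im1 y + Im6 x * oRe y + Im7 x * Im2 y)
    (oRe x * Im7 y + Im1 x * Im3 y + Im2 x * Im6 y - Im3 x * Im1 y + Im4 x * Im5 y - Im5 x * Im4 y - Im6 x * Im2 y + Im7 x * oRe y)"

instance ..

end

instantiation octo :: real_inner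
begin

definition "inner x y = oRe x * oRe y + Im1 x * Im1 y + Im2 x * Im2 y + Im3 x * Im3 y + Im4 x * Im4 y + Im5 x * Im5 y + Im6 x * Im6 y + Im7 x * Im7 y" for x y :: octo
definition "norm x = sqrt (inner x x)" for x :: octo
definition "sgn x = x /\<^sub>R norm x" for x :: octo
definition "dist x y = norm (x - y)" for x y :: octo
definition "(uniformity :: (octo \<times> octo) filter) = (INF e\<in>{0 <..}. principal {(x, y). dist x y < e})"
definition "open (U :: octo set) \<longleftrightarrow> (\<forall>x\<in>U. eventually (\<lambda>(x', y). x' = x \<longrightarrow> y \<in> U) uniformity)"

instance
proof
  fix x y z :: octo and r :: real
  show "inner x y = inner y x"
    by (simp add: inner_octo_def mult.commute)
  show "inner (x + y) z = inner x z + inner y z"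
    by (simp add: inner_octo_def plus_octo_def algebra_simps)
  show "inner (r *\<^sub>R x) y = r * inner x y"
    by (simp add: inner_octo_def scaleR_octo_def algebra_simps)
  show "0 \<le> inner x x"
    by (simp add: inner_octo_def)
  show "inner x x = 0 \<longleftrightarrow> x = 0"
    by (auto simp: inner_octo_def zero_octo_def octo_eq_iff add_nonneg_eq_0_iff)
qed (simp_all only: norm_octo_def sgn_octo_def dist_octo_def uniformity_octo_def open_octo_def)

end

definition ocnj :: "octo \<Rightarrow> octo" where
  "ocnj x = Octo (oRe x) (- Im1 x) (- Im2 x) (- Im3 x) (- Im4 x) (- Im5 x) (- Im6 x) (- Im7 x)"

lemmas octo_coords = zero_octo_def one_octo_def plus_octo_def uminus_octo_def minus_octo_def
  scaleR_octo_def times_octo_def ocnj_def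

lemma oRe_simps [simp]:
  "oRe 0 = 0" "oRe 1 = 1" "oRe (x + y) = oRe x + oRe y" "oRe (x - y) = oRe x - oRe y"
  "oRe (- x) = - oRe x" "oRe (c *\<^sub>R x) = c * oRe x" "oRe (ocnj x) = oRe x"
  by (simp_all add: octo_coords)

lemma bilinear_octo_mult: "bilinear ((*) :: octo \<Rightarrow> octo \<Rightarrow> octo)"
  unfolding bilinear_def
  by (auto intro!: linearI simp: octo_eq_iff octo_coords algebra_simps)

lemma octo_mult_1 [simp]: "1 * x = x" "x * 1 = x" for x :: octo
  by (simp_all add: octo_eq_iff octo_coords)

lemma octo_left_alternative: "x * (x * y) = (x * x) * y" for x y :: octo
  by (simp add: octo_eq_iff octo_coords algebra_simps)

lemma octo_right_alternative: "(y * x) * x = y * (x * x)" for x y :: octo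
  by (simp add: octo_eq_iff octo_coords algebra_simps)

lemma ocnj_mult: "ocnj (x * y) = ocnj y * ocnj x"
  by (simp add: octo_eq_iff octo_coords algebra_simps)

lemma ocnj_mult_self: "ocnj x * x = (norm x)\<^sup>2 *\<^sub>R 1" "x * ocnj x = (norm x)\<^sup>2 *\<^sub>R 1"
  by (simp_all add: power2_norm_eq_inner inner_octo_def octo_eq_iff octo_coords algebra_simps)

lemma ocnj_mult_cancel: "ocnj x * (x * y) = (norm x)\<^sup>2 *\<^sub>R y"
  by (simp add: power2_norm_eq_inner inner_octo_def octo_eq_iff octo_coords algebra_simps)

lemma oRe_mult_commute: "oRe (x * y) = oRe (y * x)"
  by (simp add: octo_coords algebra_simps)

lemma oRe_mult_assoc: "oRe (x * y * z) = oRe (x * (y * z))"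
  by (simp add: octo_coords algebra_simps)

lemma inner_octo_eq: "inner x y = oRe (ocnj x * y)"
  by (simp add: inner_octo_def octo_coords)

lemma norm_octo_mult: "norm (x * y) = norm x * norm y" for x y :: octo
proof -
  have "(norm (x * y))\<^sup>2 = oRe (ocnj y * (ocnj x * (x * y)))"
    by (simp only: power2_norm_eq_inner inner_octo_eq ocnj_mult oRe_mult_assoc)
  also have "\<dots> = (norm x * norm y)\<^sup>2"
    by (simp add: ocnj_mult_cancel ocnj_mult_self bilinear_rmul[OF bilinear_octo_mult]
        power_mult_distrib)
  finally show ?thesis
    by (simp add: power2_eq_iff_nonneg)
qed


section \<open>Octonionic modules and Hilbert spaces\<close>

instantiation "fun" :: (type, real_vector) real_vector
begin

definition "scaleR c f = (\<lambda>x. c *\<^sub>R f x)"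

instance
  by intro_classes (auto simp: scaleR_fun_def plus_fun_def scaleR_add_right scaleR_add_left)

end

locale left_octo_module =
  fixes smul :: "octo \<Rightarrow> 'm::real_vector \<Rightarrow> 'm"
  assumes bilinear_smul: "bilinear smul"
    and smul_one: "smul 1 m = m"
    and smul_smul_same: "smul r (smul r m) = smul (r * r) m"

text \<open>Right modules are needed for the dual space, which is a set of functions rather than a type;
  hence the carrier \<open>M\<close>, a real subspace of the ambient type.\<close>

locale right_octo_module_on =
  fixes M :: "'m::real_vector set" and rmul :: "'m \<Rightarrow> octo \<Rightarrow> 'm"
  assumes subspace_carrier: "subspace M"
    and rmul_closed: "m \<in> M \<Longrightarrow> rmul m r \<in> M"
    and linear_rmul: "m \<in> M \<Longrightarrow> linear (rmul m)"
    and rmul_add_left: "m \<in> M \<Longrightarrow> n \<in> M \<Longrightarrow> rmul (m + n) r = rmul m r + rmul n r"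
    and rmul_scaleR_left: "m \<in> M \<Longrightarrow> rmul (c *\<^sub>R m) r = c *\<^sub>R rmul m r"
    and rmul_one: "m \<in> M \<Longrightarrow> rmul m 1 = m"
    and rmul_rmul_same: "m \<in> M \<Longrightarrow> rmul (rmul m r) r = rmul m (r * r)"

text \<open>\<open>octo_assoc smul p x f\<close> is the associator \<open>[p, x, f]\<close> of a real linear map \<open>f\<close>, and
  \<open>octo_dual_mult smul f r\<close> below is \<open>f \<odot> r\<close>.\<close>

definition octo_assoc :: "(octo \<Rightarrow> 'm::real_vector \<Rightarrow> 'm) \<Rightarrow> octo \<Rightarrow> 'm \<Rightarrow> ('m \<Rightarrow> octo) \<Rightarrow> octo" where
  "octo_assoc smul p x f = f (smul p x) - p * f x"

definition para_linear :: "(octo \<Rightarrow> 'm::real_vector \<Rightarrow> 'm) \<Rightarrow> ('m \<Rightarrow> octo) \<Rightarrow> bool" where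
  "para_linear smul f \<longleftrightarrow> linear f \<and> (\<forall>p x. oRe (octo_assoc smul p x f) = 0)"

definition octo_norm :: "('h::real_vector \<Rightarrow> 'h \<Rightarrow> octo) \<Rightarrow> 'h \<Rightarrow> real" where
  "octo_norm ip u = sqrt (oRe (ip u u))"

definition octo_dist :: "('h::real_vector \<Rightarrow> 'h \<Rightarrow> octo) \<Rightarrow> 'h \<Rightarrow> 'h \<Rightarrow> real" where
  "octo_dist ip u v = octo_norm ip (u - v)"

locale pre_hilbert_octo_module = left_octo_module smul
  for smul :: "octo \<Rightarrow> 'h::real_vector \<Rightarrow> 'h" +
  fixes ip :: "'h \<Rightarrow> 'h \<Rightarrow> octo"
  assumes bilinear_ip: "bilinear ip"
    and para_linear_ip: "para_linear smul (\<lambda>x. ip x u)"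
    and ip_conj: "ip u v = ocnj (ip v u)"
    and ip_self_nonneg: "\<exists>c\<ge>0. ip u u = c *\<^sub>R 1"
    and ip_self_eq_0_iff: "ip u u = 0 \<longleftrightarrow> u = 0"

context pre_hilbert_octo_module
begin

lemma oRe_ip_nonneg: "0 \<le> oRe (ip u u)"
  using ip_self_nonneg[of u] by auto

lemma octo_norm_power2: "(octo_norm ip u)\<^sup>2 = oRe (ip u u)"
  by (simp add: octo_norm_def oRe_ip_nonneg)

lemma octo_norm_nonneg: "0 \<le> octo_norm ip u"
  by (simp add: octo_norm_def oRe_ip_nonneg)

lemma octo_norm_eq_0_iff: "octo_norm ip u = 0 \<longleftrightarrow> u = 0"
  using ip_self_nonneg[of u] ip_self_eq_0_iff[of u]
  by (auto simp: octo_norm_def)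

lemma oRe_ip_commute: "oRe (ip u v) = oRe (ip v u)"
  by (metis ip_conj oRe_simps(7))

lemmas ip_simps = bilinear_ladd[OF bilinear_ip] bilinear_radd[OF bilinear_ip]
  bilinear_lmul[OF bilinear_ip] bilinear_rmul[OF bilinear_ip]
  bilinear_lsub[OF bilinear_ip] bilinear_rsub[OF bilinear_ip]

lemma Cauchy_Schwarz_oRe: "oRe (ip u v) \<le> octo_norm ip u * octo_norm ip v"
proof (cases "u = 0 \<or> v = 0")
  case True
  then show ?thesis
    using bilinear_lzero[OF bilinear_ip] bilinear_rzero[OF bilinear_ip]
    by (auto simp: octo_norm_def)
next
  case False
  define a b where "a = octo_norm ip u" and "b = octo_norm ip v"
  have pos: "a > 0" "b > 0"
    using False octo_norm_nonneg[of u] octo_norm_nonneg[of v]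
      octo_norm_eq_0_iff[of u] octo_norm_eq_0_iff[of v]
    by (auto simp: a_def b_def)
  have "0 \<le> oRe (ip (b *\<^sub>R u - a *\<^sub>R v) (b *\<^sub>R u - a *\<^sub>R v))"
    by (rule oRe_ip_nonneg)
  also have "\<dots> = b * b * a\<^sup>2 - 2 * (a * b) * oRe (ip u v) + a * a * b\<^sup>2"
    by (simp add: ip_simps a_def b_def octo_norm_power2 oRe_ip_commute[of v u] algebra_simps)
  also have "\<dots> = 2 * (a * b) * (a * b - oRe (ip u v))"
    by (simp add: power2_eq_square algebra_simps)
  finally show ?thesis
    using pos mult_pos_pos[OF pos] by (simp add: zero_le_mult_iff flip: a_def b_def)
qed

lemma octo_norm_triangle: "octo_norm ip (u + v) \<le> octo_norm ip u + octo_norm ip v"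
proof (rule power2_le_imp_le)
  show "(octo_norm ip (u + v))\<^sup>2 \<le> (octo_norm ip u + octo_norm ip v)\<^sup>2"
    using Cauchy_Schwarz_oRe[of u v] oRe_ip_commute[of v u]
    by (simp add: octo_norm_power2 power2_sum ip_simps)
qed (simp add: octo_norm_nonneg)

lemma octo_norm_scaleR: "octo_norm ip (c *\<^sub>R u) = \<bar>c\<bar> * octo_norm ip u"
  by (simp add: octo_norm_def ip_simps real_sqrt_mult flip: mult.assoc)

sublocale Metric_space UNIV "octo_dist ip"
proof
  fix x y z :: 'h
  show "0 \<le> octo_dist ip x y"
    by (simp add: octo_dist_def octo_norm_nonneg)
  show "octo_dist ip x y = octo_dist ip y x"
    using octo_norm_scaleR[of "-1" "x - y"] by (simp add: octo_dist_def)
  show "octo_dist ip x y = 0 \<longleftrightarrow> x = y"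
    by (simp add: octo_dist_def octo_norm_eq_0_iff)
  show "octo_dist ip x z \<le> octo_dist ip x y + octo_dist ip y z"
    using octo_norm_triangle[of "x - y" "y - z"] by (simp add: octo_dist_def)
qed

end

locale octo_hilbert_space = pre_hilbert_octo_module +
  assumes complete: mcomplete


section \<open>The dual space\<close>

definition octo_dual ::
  "(octo \<Rightarrow> 'h::real_vector \<Rightarrow> 'h) \<Rightarrow> ('h \<Rightarrow> 'h \<Rightarrow> octo) \<Rightarrow> ('h \<Rightarrow> octo) set" where
  "octo_dual smul ip =
    {f. para_linear smul f \<and> continuous_map (Metric_space.mtopology UNIV (octo_dist ip)) euclidean f}"

text \<open>The supremum is a real one; it is meaningful on \<^const>\<open>octo_dual\<close>, whose members are bounded
  on the unit ball.\<close>

definition octo_dual_norm :: "('h::real_vector \<Rightarrow> 'h \<Rightarrow> octo) \<Rightarrow> ('h \<Rightarrow> octo) \<Rightarrow> real" where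
  "octo_dual_norm ip f = (SUP x\<in>{x. octo_norm ip x \<le> 1}. norm (f x))"

definition octo_dual_mult ::
  "(octo \<Rightarrow> 'h::real_vector \<Rightarrow> 'h) \<Rightarrow> ('h \<Rightarrow> octo) \<Rightarrow> octo \<Rightarrow> 'h \<Rightarrow> octo" where
  "octo_dual_mult smul f r = (\<lambda>x. f x * r - octo_assoc smul r x f)"

context pre_hilbert_octo_module
begin

lemma octo_norm_smul: "octo_norm ip (smul r x) = norm r * octo_norm ip x"
proof -
  have re: "oRe (ip (smul p u) v) = oRe (p * ip u v)" for p u v
    using para_linear_ip[of v] by (simp add: para_linear_def octo_assoc_def)
  have cnj: "ocnj r = (2 * oRe r) *\<^sub>R 1 - r"
    by (simp add: octo_eq_iff octo_coords)
  have "smul (ocnj r) (smul r x) = (2 * oRe r) *\<^sub>R smul r x - smul (r * r) x"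
    by (simp add: cnj bilinear_lsub[OF bilinear_smul] bilinear_lmul[OF bilinear_smul]
        smul_one smul_smul_same)
  also have "\<dots> = smul (((2 * oRe r) *\<^sub>R 1 - r) * r) x"
    by (simp add: bilinear_lsub[OF bilinear_smul] bilinear_lmul[OF bilinear_smul]
        bilinear_lsub[OF bilinear_octo_mult] bilinear_lmul[OF bilinear_octo_mult])
  also have "\<dots> = (norm r)\<^sup>2 *\<^sub>R x"
    by (simp add: ocnj_mult_self bilinear_lmul[OF bilinear_smul] smul_one flip: cnj)
  finally have *: "smul (ocnj r) (smul r x) = (norm r)\<^sup>2 *\<^sub>R x" .
  have "oRe (ip (smul r x) (smul r x)) = oRe (r * ip x (smul r x))"
    by (rule re)
  also have "\<dots> = oRe (ocnj (r * ip x (smul r x)))"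
    by simp
  also have "\<dots> = oRe (ocnj r * ip (smul r x) x)"
    by (simp only: ocnj_mult flip: ip_conj) (rule oRe_mult_commute)
  also have "\<dots> = (norm r)\<^sup>2 * oRe (ip x x)"
    by (simp add: * ip_simps flip: re)
  finally show ?thesis
    by (simp add: octo_norm_def real_sqrt_mult)
qed

lemma octo_dualD:
  assumes "f \<in> octo_dual smul ip"
  shows "linear f" "oRe (f (smul p x)) = oRe (p * f x)" "continuous_map mtopology euclidean f"
  using assms by (auto simp: octo_dual_def para_linear_def octo_assoc_def)

lemma octo_dualI:
  assumes "linear f" "\<And>p x. oRe (f (smul p x)) = oRe (p * f x)"
    "continuous_map mtopology euclidean f"
  shows "f \<in> octo_dual smul ip"
  using assms by (auto simp: octo_dual_def para_linear_def octo_assoc_def)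

lemma octo_dual_eqI:
  assumes f: "f \<in> octo_dual smul ip" and g: "g \<in> octo_dual smul ip"
    and eq: "\<And>x. oRe (f x) = oRe (g x)"
  shows "f = g"
proof
  fix x
  have "oRe (p * (f x - g x)) = 0" for p
    using eq[of "smul p x"]
    by (simp add: octo_dualD(2)[OF f] octo_dualD(2)[OF g] bilinear_rsub[OF bilinear_octo_mult])
  then have "inner (f x - g x) (f x - g x) = 0"
    by (simp add: inner_octo_eq)
  then show "f x = g x"
    by simp
qed

lemma oRe_octo_dual_mult:
  assumes "f \<in> octo_dual smul ip"
  shows "oRe (octo_dual_mult smul f r x) = oRe (f (smul r x))"
  by (simp add: octo_dual_mult_def octo_assoc_def octo_dualD(2)[OF assms] oRe_mult_commute)

lemma subspace_octo_dual: "subspace (octo_dual smul ip)"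
proof (rule subspaceI)
  show "0 \<in> octo_dual smul ip"
    by (rule octo_dualI)
      (auto intro!: linearI simp: zero_fun_def bilinear_rzero[OF bilinear_octo_mult])
  fix f g c assume f: "f \<in> octo_dual smul ip" and g: "g \<in> octo_dual smul ip"
  show "f + g \<in> octo_dual smul ip"
  proof (rule octo_dualI)
    show "linear (f + g)"
      using linear_compose_add[OF octo_dualD(1)[OF f] octo_dualD(1)[OF g]]
      by (simp add: plus_fun_def)
    show "continuous_map mtopology euclidean (f + g)"
      using continuous_map_add[OF octo_dualD(3)[OF f] octo_dualD(3)[OF g]]
      by (simp add: plus_fun_def)
  qed (simp add: octo_dualD(2)[OF f] octo_dualD(2)[OF g] bilinear_radd[OF bilinear_octo_mult])
  show "c *\<^sub>R f \<in> octo_dual smul ip"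
  proof (rule octo_dualI)
    show "linear (c *\<^sub>R f)"
      using linear_compose_scale_right[OF octo_dualD(1)[OF f], of c]
      by (simp add: scaleR_fun_def)
    have "continuous_map euclidean euclidean (\<lambda>y::octo. c *\<^sub>R y)"
      by (simp add: continuous_intros)
    from continuous_map_compose[OF octo_dualD(3)[OF f] this]
    show "continuous_map mtopology euclidean (c *\<^sub>R f)"
      by (simp add: scaleR_fun_def o_def)
  qed (simp add: octo_dualD(2)[OF f] scaleR_fun_def bilinear_rmul[OF bilinear_octo_mult])
qed

lemma octo_dual_mult_closed:
  assumes f: "f \<in> octo_dual smul ip"
  shows "octo_dual_mult smul f r \<in> octo_dual smul ip"
proof (rule octo_dualI)
  note lin = octo_dualD(1)[OF f] and re = octo_dualD(2)[OF f]
  note bil = bilinear_ladd[OF bilinear_octo_mult] bilinear_radd[OF bilinear_octo_mult]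
    bilinear_lmul[OF bilinear_octo_mult] bilinear_rmul[OF bilinear_octo_mult]
    bilinear_radd[OF bilinear_smul] bilinear_rmul[OF bilinear_smul]
  show "linear (octo_dual_mult smul f r)"
    by (rule linearI)
      (simp_all add: octo_dual_mult_def octo_assoc_def bil linear_add[OF lin]
        linear_scale[OF lin] algebra_simps)
  have polar: "smul r (smul p x) + smul p (smul r x) = smul (r * p + p * r) x" for p x
    using smul_smul_same[of "r + p" x]
    by (simp add: smul_smul_same bilinear_ladd[OF bilinear_smul] bil algebra_simps)
  show "oRe (octo_dual_mult smul f r (smul p x)) = oRe (p * octo_dual_mult smul f r x)" for p x
  proof -
    have "oRe (f (smul r (smul p x))) + oRe (f (smul p (smul r x)))
        = oRe (f (smul r (smul p x) + smul p (smul r x)))"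
      by (simp add: linear_add[OF lin])
    also have "\<dots> = oRe ((r * p + p * r) * f x)"
      by (simp only: polar re)
    also have "\<dots> = oRe (p * (f x * r)) + oRe (p * (r * f x))"
      by (simp add: bil oRe_mult_assoc[symmetric])
        (metis oRe_mult_assoc oRe_mult_commute)
    finally show ?thesis
      unfolding oRe_octo_dual_mult[OF f]
      by (simp add: octo_dual_mult_def octo_assoc_def bilinear_rsub[OF bilinear_octo_mult]
          re[of p "smul r x"])
  qed
  have smul_cont: "continuous_map mtopology mtopology (smul r)"
    unfolding metric_continuous_map[OF Metric_space_axioms]
  proof (intro conjI ballI allI impI)
    fix a and e :: real assume "e > 0"
    have "octo_dist ip (smul r a) (smul r x) < e" if "octo_dist ip a x < e / (norm r + 1)" for x
    proof -
      have "octo_dist ip (smul r a) (smul r x) = norm r * octo_dist ip a x"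
        by (simp add: octo_dist_def octo_norm_smul flip: bilinear_rsub[OF bilinear_smul])
      also have "\<dots> \<le> (norm r + 1) * octo_dist ip a x"
        by (simp add: mult_right_mono)
      also have "\<dots> < e"
        using that by (simp add: field_simps add_pos_nonneg)
      finally show ?thesis .
    qed
    then show "\<exists>d>0. \<forall>x. x \<in> UNIV \<and> octo_dist ip a x < d \<longrightarrow> octo_dist ip (smul r a) (smul r x) < e"
      using \<open>e > 0\<close> by (intro exI[of _ "e / (norm r + 1)"]) (auto simp: add_nonneg_pos)
  qed simp
  have "bounded_linear (\<lambda>y. y * r)"
    by (rule bounded_linear_intro[where K = "norm r"]) (simp_all add: bil norm_octo_mult)
  moreover have "bounded_linear (\<lambda>y. r * y)"
    by (rule bounded_linear_intro[where K = "norm r"])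
      (simp_all add: bil norm_octo_mult mult.commute)
  ultimately have "continuous_map euclidean euclidean (\<lambda>y. y * r)"
    "continuous_map euclidean euclidean (\<lambda>y. r * y)"
    by (simp_all add: linear_continuous_on)
  from this[THEN continuous_map_compose[OF octo_dualD(3)[OF f]]]
  show "continuous_map mtopology euclidean (octo_dual_mult smul f r)"
    unfolding octo_dual_mult_def octo_assoc_def o_def
    by (intro continuous_map_diff continuous_map_compose[OF smul_cont octo_dualD(3)[OF f], unfolded o_def])
qed

lemma right_octo_module_octo_dual:
  "right_octo_module_on (octo_dual smul ip) (octo_dual_mult smul)"
proof (rule right_octo_module_on.intro)
  note bil = bilinear_ladd[OF bilinear_octo_mult] bilinear_radd[OF bilinear_octo_mult]
    bilinear_lmul[OF bilinear_octo_mult] bilinear_rmul[OF bilinear_octo_mult]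
    bilinear_ladd[OF bilinear_smul] bilinear_lmul[OF bilinear_smul]
  fix f g r c
  assume f: "f \<in> octo_dual smul ip"
  note lin = octo_dualD(1)[OF f]
  show "octo_dual_mult smul f r \<in> octo_dual smul ip"
    by (rule octo_dual_mult_closed[OF f])
  show "linear (octo_dual_mult smul f)"
    by (rule linearI)
      (auto simp: fun_eq_iff octo_dual_mult_def octo_assoc_def scaleR_fun_def bil
        linear_add[OF lin] linear_scale[OF lin] algebra_simps)
  show "octo_dual_mult smul (f + g) r = octo_dual_mult smul f r + octo_dual_mult smul g r"
    by (auto simp: fun_eq_iff octo_dual_mult_def octo_assoc_def bil algebra_simps)
  show "octo_dual_mult smul (c *\<^sub>R f) r = c *\<^sub>R octo_dual_mult smul f r"
    by (auto simp: fun_eq_iff octo_dual_mult_def octo_assoc_def scaleR_fun_def bil algebra_simps)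
  show "octo_dual_mult smul f 1 = f"
    by (auto simp: fun_eq_iff octo_dual_mult_def octo_assoc_def smul_one)
  show "octo_dual_mult smul (octo_dual_mult smul f r) r = octo_dual_mult smul f (r * r)"
    by (rule octo_dual_eqI)
      (simp_all add: f octo_dual_mult_closed oRe_octo_dual_mult smul_smul_same)
qed (rule subspace_octo_dual)

end

end

theory Submission
  imports Defs
begin

text \<open>A para-linear functional is determined by its real part (\<open>octo_dual_eqI\<close>), so it suffices to
  represent \<open>Re f\<close> in the real Hilbert space \<open>(H, Re \<langle>\<cdot>,\<cdot>\<rangle>)\<close>. The representing vector is the minimiser
  of \<open>\<parallel>x\<parallel>\<^sup>2 - 2 Re f(x)\<close>, which exists by the parallelogram law and completeness. Conjugate linearity
  of \<open>\<sigma>\<close> is the adjunction \<open>Re \<langle>rx, z\<rangle> = Re \<langle>x, ocnj r z\<rangle>\<close>.\<close>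

context pre_hilbert_octo_module
begin

section \<open>The adjoint of scalar multiplication and the octonionic Cauchy-Schwarz
  inequality\<close>

lemma oRe_ip_smul_left: "oRe (ip (smul p u) v) = oRe (p * ip u v)"
  using para_linear_ip[of v] by (simp add: para_linear_def octo_assoc_def)

text \<open>Conjugation preserves real parts and swaps the arguments of \<open>ip\<close>, so the
  rule for scalars in the first argument transfers to the second.\<close>

lemma oRe_ip_smul_adjoint: "oRe (ip (smul r u) v) = oRe (ip u (smul (ocnj r) v))"
proof -
  have "oRe (ip (smul r u) v) = oRe (ocnj (r * ip u v))"
    by (simp add: oRe_ip_smul_left)
  also have "\<dots> = oRe (ocnj r * ip v u)"
    by (simp only: ocnj_mult flip: ip_conj) (rule oRe_mult_commute)
  also have "\<dots> = oRe (ip u (smul (ocnj r) v))"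
    by (simp only: oRe_ip_commute[of u] oRe_ip_smul_left)
  finally show ?thesis .
qed

text \<open>Multiplying \<open>x\<close> by the conjugate of \<open>ip x z\<close> moves the whole
  norm of \<open>ip x z\<close> into the real part, where the real Cauchy-Schwarz inequality
  applies; one factor \<open>norm (ip x z)\<close> then cancels.\<close>

lemma norm_ip_le: "norm (ip x z) \<le> octo_norm ip x * octo_norm ip z"
proof (cases "ip x z = 0")
  case False
  have "(norm (ip x z))\<^sup>2 = oRe (ip (smul (ocnj (ip x z)) x) z)"
    by (simp add: oRe_ip_smul_left ocnj_mult_self)
  also have "\<dots> \<le> norm (ocnj (ip x z)) * octo_norm ip x * octo_norm ip z"
    using Cauchy_Schwarz_oRe[of "smul (ocnj (ip x z)) x" z] by (simp add: octo_norm_smul)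
  also have "norm (ocnj (ip x z)) = norm (ip x z)"
    by (simp add: norm_octo_def inner_octo_def ocnj_def)
  finally show ?thesis
    using False by (simp add: power2_eq_square mult.assoc)
qed (simp add: octo_norm_nonneg)

lemma linear_ip_left: "linear (\<lambda>x. ip x z)"
  using bilinear_ip by (simp add: bilinear_def)

section \<open>Boundedness and continuity of real linear maps\<close>

lemma continuous_map_bounded_linear:
  fixes f :: "'h \<Rightarrow> 'b::real_normed_vector"
  assumes lin: "linear f" and le: "\<And>x. norm (f x) \<le> K * octo_norm ip x"
  shows "continuous_map mtopology euclidean f"
proof -
  have "\<exists>d>0. \<forall>x. octo_dist ip a x < d \<longrightarrow> dist (f a) (f x) < e" if "e > 0" for a and e :: real
  \<comment> \<open>The denominator is positive even if \<open>K\<close> is zero or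
    negative.\<close>
  proof (intro exI[of _ "e / (\<bar>K\<bar> + 1)"] conjI allI impI)
    fix x assume x: "octo_dist ip a x < e / (\<bar>K\<bar> + 1)"
    have "dist (f a) (f x) \<le> K * octo_dist ip a x"
      using le[of "a - x"] by (simp add: dist_norm octo_dist_def linear_diff[OF lin])
    also have "\<dots> \<le> (\<bar>K\<bar> + 1) * octo_dist ip a x"
      by (intro mult_right_mono) auto
    also have "\<dots> < e"
      using x by (simp add: field_simps)
    finally show "dist (f a) (f x) < e" .
  qed (use that in \<open>simp add: add_nonneg_pos\<close>)
  then show ?thesis
    unfolding mtopology_is_euclidean[symmetric]
      metric_continuous_map[OF Met_TC.Metric_space_axioms]
    by simp
qed

lemma bounded_if_continuous_map:
  fixes f :: "'h \<Rightarrow> 'b::real_normed_vector"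
  assumes lin: "linear f" and cont: "continuous_map mtopology euclidean f"
  obtains K where "K \<ge> 0" "\<And>x. norm (f x) \<le> K * octo_norm ip x"
proof -
  obtain d where d: "d > 0" "\<And>x. octo_dist ip 0 x < d \<Longrightarrow> dist (f 0) (f x) < 1"
    using cont zero_less_one
    unfolding mtopology_is_euclidean[symmetric]
      metric_continuous_map[OF Met_TC.Metric_space_axioms]
    by (metis UNIV_I)
  have unit: "norm (f x) < 1" if "octo_norm ip x < d" for x
    using d(2)[of x] that octo_norm_scaleR[of "-1" x]
    by (simp add: octo_dist_def linear_0[OF lin])
  show thesis
  proof
    \<comment> \<open>Rescaling \<open>x\<close> to norm \<open>d / 2\<close> puts it strictly
      inside the ball on which \<open>f\<close> stays below 1.\<close>
    show "norm (f x) \<le> 2 / d * octo_norm ip x" for x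
    proof (cases "x = 0")
      case False
      define a where "a = octo_norm ip x"
      have a: "a > 0"
        using False octo_norm_nonneg[of x] octo_norm_eq_0_iff[of x] by (simp add: a_def)
      have "norm (f ((d / (2 * a)) *\<^sub>R x)) < 1"
        by (rule unit) (use a d(1) in \<open>simp add: octo_norm_scaleR flip: a_def\<close>)
      then show ?thesis
        using a d(1) by (simp add: linear_scale[OF lin] field_simps flip: a_def)
    qed (use d(1) in \<open>simp add: linear_0[OF lin] octo_norm_nonneg\<close>)
  qed (use d(1) in simp)
qed

section \<open>The functionals represented by vectors\<close>

lemma ip_in_octo_dual: "(\<lambda>x. ip x z) \<in> octo_dual smul ip"
  by (rule octo_dualI[OF linear_ip_left oRe_ip_smul_left])
    (rule continuous_map_bounded_linear[OF linear_ip_left, where K = "octo_norm ip z"],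
      simp add: norm_ip_le mult.commute)

text \<open>Cauchy-Schwarz bounds the supremum, and for nonzero \<open>z\<close> the normalised
  \<open>z\<close> attains it. This yields the isometry.\<close>

lemma octo_dual_norm_ip: "octo_dual_norm ip (\<lambda>x. ip x z) = octo_norm ip z"
  unfolding octo_dual_norm_def
proof (rule cSup_eq_maximum)
  show "octo_norm ip z \<in> (\<lambda>x. norm (ip x z)) ` {x. octo_norm ip x \<le> 1}"
  proof (cases "z = 0")
    case True
    then show ?thesis
      by (intro image_eqI[of _ _ 0])
        (simp_all add: octo_norm_def bilinear_lzero[OF bilinear_ip])
  next
    case False
    define a where "a = octo_norm ip z"
    have a: "a > 0"
      using False octo_norm_nonneg[of z] octo_norm_eq_0_iff[of z] by (simp add: a_def)
    obtain c where c: "c \<ge> 0" "ip z z = c *\<^sub>R 1"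
      using ip_self_nonneg by blast
    have "norm (1::octo) = 1"
      by (simp add: norm_octo_def inner_octo_def one_octo_def)
    moreover have "a\<^sup>2 = c"
      by (simp add: a_def octo_norm_power2 c)
    ultimately have "norm (ip (inverse a *\<^sub>R z) z) = a"
      using a c(1) by (simp add: ip_simps c(2) power2_eq_square field_simps)
    moreover have "octo_norm ip (inverse a *\<^sub>R z) \<le> 1"
      using a by (simp add: octo_norm_scaleR flip: a_def)
    ultimately show ?thesis
      by (intro image_eqI[of _ _ "inverse a *\<^sub>R z"]) (simp_all flip: a_def)
  qed
next
  fix y assume "y \<in> (\<lambda>x. norm (ip x z)) ` {x. octo_norm ip x \<le> 1}"
  then obtain x where x: "octo_norm ip x \<le> 1" "y = norm (ip x z)"
    by blast
  have "y \<le> octo_norm ip x * octo_norm ip z"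
    by (simp add: x(2) norm_ip_le)
  also have "\<dots> \<le> octo_norm ip z"
    by (rule mult_left_le_one_le[OF octo_norm_nonneg octo_norm_nonneg x(1)])
  finally show "y \<le> octo_norm ip z" .
qed

lemma inj_ip_right: "inj (\<lambda>z x. ip x z)"
proof (rule injI)
  fix u v assume "(\<lambda>x. ip x u) = (\<lambda>x. ip x v)"
  then have "ip (u - v) (u - v) = 0"
    by (simp add: fun_eq_iff bilinear_rsub[OF bilinear_ip])
  then show "u = v"
    by (simp add: ip_self_eq_0_iff)
qed

end

section \<open>Riesz representation, first real, then octonionic\<close>

context octo_hilbert_space
begin

lemma real_Riesz_representation:
  fixes \<phi> :: "'a \<Rightarrow> real"
  assumes lin: "linear \<phi>" and le: "\<And>x. \<bar>\<phi> x\<bar> \<le> K * octo_norm ip x"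
  obtains z where "\<And>x. \<phi> x = oRe (ip x z)"
proof -
  \<comment> \<open>If \<phi> is represented by \<open>z\<close>, then \<open>J x\<close> is the
    squared distance from \<open>x\<close> to \<open>z\<close> minus the squared norm of
    \<open>z\<close>.\<close>
  define J where "J x = (octo_norm ip x)\<^sup>2 - 2 * \<phi> x" for x
  define m where "m = Inf (range J)"
  have J_ge: "- K\<^sup>2 \<le> J x" for x
    using le[of x] zero_le_power2[of "octo_norm ip x - K"]
    by (simp add: J_def power2_diff algebra_simps)
  then have m_le: "m \<le> J x" for x
    unfolding m_def by (intro cInf_lower bdd_belowI[of _ "- K\<^sup>2"]) auto
  have "\<exists>x. J x < m + inverse (real (Suc n))" for n
    using cInf_lessD[of "range J" "m + inverse (real (Suc n))"] by (auto simp: m_def)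
  then obtain s where s: "\<And>n. J (s n) < m + inverse (real (Suc n))"
    by metis
  have expand: "J (z + x) = J z + 2 * (oRe (ip x z) - \<phi> x) + (octo_norm ip x)\<^sup>2" for x z
    by (simp add: J_def octo_norm_power2 ip_simps linear_add[OF lin] oRe_ip_commute[of z x])
  \<comment> \<open>The \<phi> terms cancel by linearity, leaving the parallelogram law.\<close>
  have parallelogram: "(octo_dist ip x y)\<^sup>2 = 2 * J x + 2 * J y - 4 * J ((1/2) *\<^sub>R (x + y))" for x y
    by (simp add: octo_dist_def J_def octo_norm_power2 ip_simps linear_add[OF lin]
        linear_scale[OF lin] oRe_ip_commute[of y x] algebra_simps)
  have "MCauchy s"
    unfolding MCauchy_def
  proof (intro conjI allI impI)
    fix e :: real assume e: "e > 0"
    \<comment> \<open>Both values of \<open>J\<close> are then below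
      \<open>m + e\<^sup>2 / 4\<close> and the midpoint value is at least \<open>m\<close>, so the
      squared distance is below \<open>e\<^sup>2\<close>.\<close>
    obtain N where N: "inverse (real (Suc N)) < e\<^sup>2 / 4"
      using reals_Archimedean[of "e\<^sup>2 / 4"] e by auto
    have "octo_dist ip (s i) (s j) < e" if "N \<le> i" "N \<le> j" for i j
    proof (rule power2_less_imp_less)
      have "inverse (real (Suc i)) \<le> inverse (real (Suc N))"
        "inverse (real (Suc j)) \<le> inverse (real (Suc N))"
        using that by (simp_all add: le_imp_inverse_le)
      then show "(octo_dist ip (s i) (s j))\<^sup>2 < e\<^sup>2"
        using s[of i] s[of j] m_le[of "(1/2) *\<^sub>R (s i + s j)"] N
        unfolding parallelogram by linarith
    qed (use e in simp)
    then show "\<exists>N. \<forall>n n'. N \<le> n \<longrightarrow> N \<le> n' \<longrightarrow> octo_dist ip (s n) (s n') < e"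
      by blast
  qed simp
  then obtain z where z: "limitin mtopology s z sequentially"
    using complete by (auto simp: mcomplete_def)
  have "J z \<le> m"
  proof (rule field_le_epsilon)
    fix e :: real assume e: "e > 0"
    \<comment> \<open>By \<open>expand\<close>, \<open>J z\<close> exceeds \<open>J (s n)\<close> by
      at most \<open>C\<close> times the norm of \<open>w = s n - z\<close>: Cauchy-Schwarz and the
      bound on \<phi> control the linear terms, and the square has the favourable sign. The summand
      1 keeps \<open>C\<close> positive.\<close>
    define C where "C = 2 * (octo_norm ip z + \<bar>K\<bar>) + 1"
    have C: "C > 0"
      using octo_norm_nonneg[of z] by (simp add: C_def)
    obtain N where N: "\<And>n. n \<ge> N \<Longrightarrow> octo_dist ip (s n) z < e / (2 * C)"
    proof -
      have "e / (2 * C) > 0"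
        using e C by simp
      then show thesis
        using z that unfolding limit_metric_sequentially by blast
    qed
    obtain N' where N': "inverse (real (Suc N')) < e / 2"
      using reals_Archimedean[of "e / 2"] e by auto
    define n where "n = max N N'"
    define w where "w = s n - z"
    have w: "octo_norm ip w < e / (2 * C)"
      using N[of n] by (simp add: n_def w_def octo_dist_def)
    have "\<bar>oRe (ip w z)\<bar> \<le> octo_norm ip w * octo_norm ip z"
      \<comment> \<open>The inequality is one-sided; its instance at \<open>-w\<close> supplies the
        absolute value.\<close>
      using Cauchy_Schwarz_oRe[of w z] Cauchy_Schwarz_oRe[of "- 1 *\<^sub>R w" z]
      unfolding octo_norm_scaleR bilinear_lmul[OF bilinear_ip] by simp
    moreover have "\<bar>\<phi> w\<bar> \<le> \<bar>K\<bar> * octo_norm ip w"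
      by (rule order_trans[OF le]) (simp add: mult_right_mono octo_norm_nonneg)
    moreover have "J (s n) = J z + 2 * (oRe (ip w z) - \<phi> w) + (octo_norm ip w)\<^sup>2"
      using expand[of z w] by (simp add: w_def)
    moreover have "C * octo_norm ip w
        = 2 * (octo_norm ip w * octo_norm ip z) + 2 * (\<bar>K\<bar> * octo_norm ip w) + octo_norm ip w"
      by (simp add: C_def algebra_simps)
    ultimately have "J z \<le> J (s n) + C * octo_norm ip w"
      using octo_norm_nonneg[of w] zero_le_power2[of "octo_norm ip w"]
        abs_ge_minus_self[of "oRe (ip w z)"] abs_ge_self[of "\<phi> w"]
      unfolding right_diff_distrib by linarith
    also have "C * octo_norm ip w < e / 2"
      using w C by (simp add: field_simps)
    also have "J (s n) < m + e / 2"
    proof -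
      have "inverse (real (Suc n)) \<le> inverse (real (Suc N'))"
        by (simp add: n_def le_imp_inverse_le)
      then show ?thesis
        using s[of n] N' by linarith
    qed
    finally show "J z \<le> m + e" by simp
  qed
  have "\<phi> x = oRe (ip x z)" for x
  proof (rule ccontr)
    assume neq: "\<phi> x \<noteq> oRe (ip x z)"
    define b where "b = oRe (ip x z) - \<phi> x"
    \<comment> \<open>Along \<open>z + t *\<^sub>R x\<close> the increment of \<open>J\<close> is a
      quadratic in \<open>t\<close> with slope \<open>2 * b\<close> at 0. A step against the slope
      makes it negative; the 1 in \<open>q\<close> avoids division by zero for
      \<open>x = 0\<close>.\<close>
    define q where "q = (octo_norm ip x)\<^sup>2 + 1"
    define t where "t = - b / q"
    have q: "q > 0"
      by (simp add: q_def add_nonneg_pos)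
    have "0 \<le> J (z + t *\<^sub>R x) - J z"
      using m_le[of "z + t *\<^sub>R x"] \<open>J z \<le> m\<close> by linarith
    also have "\<dots> = 2 * t * b + t\<^sup>2 * (q - 1)"
      by (simp add: expand b_def q_def ip_simps linear_scale[OF lin] octo_norm_scaleR
          power_mult_distrib algebra_simps)
    also have "\<dots> = - (b\<^sup>2 / q) - t\<^sup>2"
      using q by (simp add: t_def field_simps power2_eq_square)
    finally have "b\<^sup>2 / q + t\<^sup>2 \<le> 0"
      by simp
    moreover have "b\<^sup>2 / q > 0"
      using neq q by (simp add: b_def)
    ultimately show False
      using zero_le_power2[of t] by linarith
  qed
  then show thesis
    by (rule that)
qed

text \<open>Continuity gives a bound on \<open>f\<close>, inherited by its real part; equality of
  real parts then lifts to \<open>f\<close> itself. This is the surjectivity half of the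
  bijection.\<close>

lemma octo_Riesz_representation:
  assumes f: "f \<in> octo_dual smul ip"
  shows "\<exists>z. f = (\<lambda>x. ip x z)"
proof -
  obtain K where K: "\<And>x. norm (f x) \<le> K * octo_norm ip x"
    using bounded_if_continuous_map[OF octo_dualD(1,3)[OF f]] by blast
  have "\<bar>oRe y\<bar> \<le> norm y" for y
    using Cauchy_Schwarz_ineq2[of 1 y]
    by (simp add: inner_octo_def norm_octo_def one_octo_def)
  then have le: "\<bar>oRe (f x)\<bar> \<le> K * octo_norm ip x" for x
    using K order_trans by blast
  have "linear (\<lambda>x. oRe (f x))"
    by (rule linearI)
      (simp_all add: linear_add[OF octo_dualD(1)[OF f]] linear_scale[OF octo_dualD(1)[OF f]])
  from real_Riesz_representation[OF this le] obtain z where "\<And>x. oRe (f x) = oRe (ip x z)"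
    by blast
  then have "f = (\<lambda>x. ip x z)"
    by (rule octo_dual_eqI[OF f ip_in_octo_dual])
  then show ?thesis ..
qed

lemma bij_betw_ip_octo_dual: "bij_betw (\<lambda>z x. ip x z) UNIV (octo_dual smul ip)"
  using inj_ip_right ip_in_octo_dual octo_Riesz_representation
  unfolding bij_betw_def by blast

end

theorem theorem5p6:
  fixes smul :: "octo \<Rightarrow> 'h::real_vector \<Rightarrow> 'h"
    and ip :: "'h \<Rightarrow> 'h \<Rightarrow> octo"
  assumes "octo_hilbert_space smul ip"
  shows "\<exists>\<sigma> :: ('h \<Rightarrow> octo) \<Rightarrow> 'h.
    bij_betw \<sigma> (octo_dual smul ip) UNIV \<and>
    (\<forall>f\<in>octo_dual smul ip. \<forall>g\<in>octo_dual smul ip. \<sigma> (f + g) = \<sigma> f + \<sigma> g) \<and>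
    (\<forall>f\<in>octo_dual smul ip. \<forall>c. \<sigma> (c *\<^sub>R f) = c *\<^sub>R \<sigma> f) \<and>
    (\<forall>f\<in>octo_dual smul ip. octo_norm ip (\<sigma> f) = octo_dual_norm ip f) \<and>
    (\<forall>f\<in>octo_dual smul ip. \<forall>r. \<sigma> (octo_dual_mult smul f r) = smul (ocnj r) (\<sigma> f))"
proof -
  interpret octo_hilbert_space smul ip
    by (rule assms)
  \<comment> \<open>Every member of the dual is some \<open>\<lambda>x. ip x z\<close>, so all
    claims about this inverse reduce to identities between such functionals.\<close>
  define \<sigma> where "\<sigma> = inv (\<lambda>z x. ip x z)"
  have \<sigma>_ip: "\<sigma> (\<lambda>x. ip x z) = z" for z
    using inv_f_f[OF inj_ip_right, of z] by (simp add: \<sigma>_def)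
  \<comment> \<open>Both sides lie in the dual, so comparing real parts suffices; there the twisted
    product becomes precomposition with \<open>smul r\<close>, and the adjunction applies.\<close>
  have mult: "octo_dual_mult smul (\<lambda>x. ip x z) r = (\<lambda>x. ip x (smul (ocnj r) z))" for r z
    by (rule octo_dual_eqI)
      (simp_all add: ip_in_octo_dual octo_dual_mult_closed oRe_octo_dual_mult oRe_ip_smul_adjoint)
  have add: "(\<lambda>x. ip x u) + (\<lambda>x. ip x v) = (\<lambda>x. ip x (u + v))" for u v
    by (simp add: fun_eq_iff ip_simps)
  have scale: "c *\<^sub>R (\<lambda>x. ip x u) = (\<lambda>x. ip x (c *\<^sub>R u))" for c u
    by (simp add: fun_eq_iff scaleR_fun_def ip_simps)
  show ?thesis
  proof (intro exI[of _ \<sigma>] conjI ballI allI)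
    show "bij_betw \<sigma> (octo_dual smul ip) UNIV"
      unfolding \<sigma>_def by (rule bij_betw_inv_into[OF bij_betw_ip_octo_dual])
  qed (auto dest!: octo_Riesz_representation simp: add scale mult \<sigma>_ip octo_dual_norm_ip)
qed

end
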